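(* Let $A\in\mathbb{C}^{n\times n}$ be a strictly diagonally dominant matrix, let $m$ be an integer with $1\le m<n$, and let $0<\omega\le 1$. Then the generalized SOR (GSOR) method with parameters $m$ and $\omega$ for the system $Ax=b$ converges.
   Context: An $n\times n$ matrix $A=(a_{ij})$ is strictly diagonally dominant (SDD) if $|a_{ii}|>\sum_{j\ne i}|a_{ij}|$ for $i=1,\dots,n$. For an $n\times n$ matrix $A=(a_{ij})$ and an integer $1\le m<n$, write $A=T_m-E_m-F_m$, where $T_m$ has entries $a_{ij}$ if $|i-j|\le m$ and $0$ otherwise; $E_m$ has entries $-a_{ij}$ if $i>j+m$ and $0$ otherwise; $F_m$ has entries $-a_{ij}$ if $j>i+m$ and $0$ otherwise. The GSOR method with parameters $m$ and $\omega$ is the iteration $$x^{(k+1)}=(T_m-\omega E_m)^{-1}\left[(1-\omega)T_m+\omega F_m\right]x^{(k)}+\omega(T_m-\omega E_m)^{-1}b,\qquad k\ge 0.$$ "The method converges" means that $T_m-\omega E_m$ is invertible (so the iteration is defined) and that for every $b$ and every initial guess $x^{(0)}$ in $\mathbb{C}^n$ the sequence $x^{(k)}$ converges to the solution of $Ax=b$; equivalently, $T_m-\omega E_m$ is invertible and $\rho\big((T_m-\omega E_m)^{-1}[(1-\omega)T_m+\omega F_m]\big)<1$, where $\rho$ denotes the spectral radius. *)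

theory Defs
  imports Complex_Main "Jordan_Normal_Form.Gauss_Jordan_Elimination"
begin

definition strictly_diagonally_dominant :: "complex mat \<Rightarrow> bool" where
  "strictly_diagonally_dominant A \<longleftrightarrow>
     (\<forall>i < dim_row A. norm (A $$ (i,i)) > (\<Sum>j\<in>{..<dim_col A} - {i}. norm (A $$ (i,j))))"

text \<open>Rows and columns are numbered from 0; the conditions on \<open>i\<close> and \<open>j\<close> below depend
  only on the difference of the indices, so this shift does not affect them.\<close>

definition band_part :: "nat \<Rightarrow> complex mat \<Rightarrow> complex mat" where
  "band_part m A = mat (dim_row A) (dim_col A)
     (\<lambda>(i,j). if \<bar>int i - int j\<bar> \<le> int m then A $$ (i,j) else 0)"

definition lower_part :: "nat \<Rightarrow> complex mat \<Rightarrow> complex mat" where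
  "lower_part m A = mat (dim_row A) (dim_col A)
     (\<lambda>(i,j). if i > j + m then - A $$ (i,j) else 0)"

definition upper_part :: "nat \<Rightarrow> complex mat \<Rightarrow> complex mat" where
  "upper_part m A = mat (dim_row A) (dim_col A)
     (\<lambda>(i,j). if j > i + m then - A $$ (i,j) else 0)"

lemma splitting:
  "A = band_part m A - lower_part m A - upper_part m A"
  by (rule eq_matI) (auto simp: band_part_def lower_part_def upper_part_def)

definition gsor_lhs :: "complex mat \<Rightarrow> nat \<Rightarrow> real \<Rightarrow> complex mat" where
  "gsor_lhs A m \<omega> = band_part m A - complex_of_real \<omega> \<cdot>\<^sub>m lower_part m A"

definition gsor_rhs :: "complex mat \<Rightarrow> nat \<Rightarrow> real \<Rightarrow> complex mat" where
  "gsor_rhs A m \<omega> =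
     complex_of_real (1 - \<omega>) \<cdot>\<^sub>m band_part m A + complex_of_real \<omega> \<cdot>\<^sub>m upper_part m A"

text \<open>\<^const>\<open>mat_inverse\<close> is \<^const>\<open>None\<close> on singular matrices, so the inverse
  below is meaningful only if \<open>gsor_lhs A m \<omega>\<close> is invertible; this is part of
  the definition of convergence.\<close>

primrec gsor_iterate ::
  "complex mat \<Rightarrow> nat \<Rightarrow> real \<Rightarrow> complex vec \<Rightarrow> complex vec \<Rightarrow> nat \<Rightarrow> complex vec" where
  "gsor_iterate A m \<omega> b x0 0 = x0"
| "gsor_iterate A m \<omega> b x0 (Suc k) =
     (the (mat_inverse (gsor_lhs A m \<omega>)) * gsor_rhs A m \<omega>) *\<^sub>v gsor_iterate A m \<omega> b x0 k
     + complex_of_real \<omega> \<cdot>\<^sub>v (the (mat_inverse (gsor_lhs A m \<omega>)) *\<^sub>v b)"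

text \<open>The type \<^typ>\<open>complex vec\<close> carries no topology; convergence in $\mathbb{C}^n$ is
  convergence of every component.\<close>

definition vec_converges_to :: "nat \<Rightarrow> (nat \<Rightarrow> complex vec) \<Rightarrow> complex vec \<Rightarrow> bool" where
  "vec_converges_to n X x \<longleftrightarrow>
     (\<forall>k. X k \<in> carrier_vec n) \<and> x \<in> carrier_vec n \<and>
     (\<forall>i < n. (\<lambda>k. X k $ i) \<longlonglongrightarrow> x $ i)"

text \<open>The set equation says that \<open>x\<close> is the unique solution of \<open>A x = b\<close>.\<close>

definition gsor_converges :: "complex mat \<Rightarrow> nat \<Rightarrow> real \<Rightarrow> bool" where
  "gsor_converges A m \<omega> \<longleftrightarrow>
     invertible_mat (gsor_lhs A m \<omega>) \<and>
     (\<forall>b \<in> carrier_vec (dim_row A). \<exists>x.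
        {y \<in> carrier_vec (dim_col A). A *\<^sub>v y = b} = {x} \<and>
        (\<forall>x0 \<in> carrier_vec (dim_col A).
           vec_converges_to (dim_col A) (gsor_iterate A m \<omega> b x0) x))"

end

theory Submission
  imports Defs "Jordan_Normal_Form.Determinant"
begin

text \<open>The errors satisfy \<open>T (e' - (1 - \<omega>) e) = \<omega> (E e' + F e)\<close>. Diagonal dominance of \<open>A\<close> says
  that the absolute row sums of \<open>E\<close> and \<open>F\<close> together are at most \<open>q\<close> times the dominance gap
  \<open>|t\<^sub>i\<^sub>i| - \<Sum>\<^bsub>j \<noteq> i\<^esub> |t\<^sub>i\<^sub>j|\<close> of the band part \<open>T\<close>, for some \<open>q < 1\<close>, so in the maximum norm
  \<open>|e' - (1 - \<omega>) e| \<le> \<omega> q max |e| |e'|\<close>. Hence \<open>|e'| \<le> (1 - \<omega> (1 - q)) |e|\<close>.\<close>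

section \<open>Dominance gaps, absolute row sums and maximum-norm estimates\<close>

definition dominance_gap :: "complex mat \<Rightarrow> nat \<Rightarrow> real" where
  "dominance_gap A i = norm (A $$ (i,i)) - (\<Sum>j\<in>{..<dim_col A} - {i}. norm (A $$ (i,j)))"

definition abs_row_sum :: "complex mat \<Rightarrow> nat \<Rightarrow> real" where
  "abs_row_sum A i = (\<Sum>j<dim_col A. norm (A $$ (i,j)))"

lemma abs_row_sum_nonneg: "0 \<le> abs_row_sum A i"
  by (simp add: abs_row_sum_def sum_nonneg)

lemma mult_mat_vec_index_sum:
  assumes "A \<in> carrier_mat n n" "v \<in> carrier_vec n" "i < n"
  shows "(A *\<^sub>v v) $ i = (\<Sum>j<n. A $$ (i,j) * v $ j)"
  using assms by (auto simp: scalar_prod_def atLeast0LessThan intro!: sum.cong)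

lemma smult_mult_mat_vec:
  fixes A :: "'a :: comm_ring_1 mat"
  assumes "A \<in> carrier_mat n n" "v \<in> carrier_vec n"
  shows "(k \<cdot>\<^sub>m A) *\<^sub>v v = k \<cdot>\<^sub>v (A *\<^sub>v v)"
  using assms by (intro eq_vecI) (auto intro!: smult_scalar_prod_distrib[where n = n])

lemma ex_argmax_lessThan:
  fixes f :: "nat \<Rightarrow> real"
  assumes "j < n"
  obtains i where "i < n" "\<And>k. k < n \<Longrightarrow> f k \<le> f i"
proof -
  have "Max (f ` {..<n}) \<in> f ` {..<n}" using assms by (intro Max_in) auto
  then obtain i where i: "i < n" "Max (f ` {..<n}) = f i" by auto
  moreover have "f k \<le> f i" if "k < n" for k
    unfolding i(2)[symmetric] using that by (intro Max_ge) auto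
  ultimately show ?thesis using that by blast
qed

lemma norm_mult_mat_vec_le:
  assumes "A \<in> carrier_mat n n" "v \<in> carrier_vec n" "i < n"
    and "\<And>j. j < n \<Longrightarrow> norm (v $ j) \<le> c"
  shows "norm ((A *\<^sub>v v) $ i) \<le> abs_row_sum A i * c"
proof -
  have "norm ((A *\<^sub>v v) $ i) \<le> (\<Sum>j<n. norm (A $$ (i,j) * v $ j))"
    unfolding mult_mat_vec_index_sum[OF assms(1-3)] by (rule norm_sum)
  also have "\<dots> \<le> (\<Sum>j<n. norm (A $$ (i,j)) * c)"
    using assms(4) by (intro sum_mono) (auto simp: norm_mult intro!: mult_left_mono)
  finally show ?thesis using assms(1) by (simp add: abs_row_sum_def sum_distrib_right)
qed

text \<open>In a row \<open>i\<close> where the entry of \<open>v\<close> has maximal modulus, every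
  off-diagonal term is at most \<open>norm (A $$ (i,k)) * norm (v $ i)\<close>. The reverse triangle
  inequality then gives \<open>dominance_gap A i * norm (v $ i)\<close> as a lower bound for the
  modulus of that entry of the product, and the positive gap cancels.\<close>

lemma dominance_gap_solution_bound:
  assumes A: "A \<in> carrier_mat n n" and v: "v \<in> carrier_vec n"
    and gap: "\<And>i. i < n \<Longrightarrow> 0 < dominance_gap A i"
    and le: "\<And>i. i < n \<Longrightarrow> norm ((A *\<^sub>v v) $ i) \<le> c * dominance_gap A i"
    and "j < n"
  shows "norm (v $ j) \<le> c"
proof -
  obtain i where i: "i < n" and max: "\<And>k. k < n \<Longrightarrow> norm (v $ k) \<le> norm (v $ i)"
    using ex_argmax_lessThan[OF \<open>j < n\<close>, of "\<lambda>k. norm (v $ k)"] by blast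
  let ?S = "\<Sum>k\<in>{..<n} - {i}. A $$ (i,k) * v $ k"
  have "norm ?S \<le> (\<Sum>k\<in>{..<n} - {i}. norm (A $$ (i,k) * v $ k))" by (rule norm_sum)
  also have "\<dots> \<le> (\<Sum>k\<in>{..<n} - {i}. norm (A $$ (i,k)) * norm (v $ i))"
    using max by (intro sum_mono) (auto simp: norm_mult intro!: mult_left_mono)
  finally have S: "norm ?S \<le> (\<Sum>k\<in>{..<n} - {i}. norm (A $$ (i,k))) * norm (v $ i)"
    by (simp add: sum_distrib_right)
  have "(A *\<^sub>v v) $ i = A $$ (i,i) * v $ i + ?S"
    unfolding mult_mat_vec_index_sum[OF A v i] using i by (simp add: sum.remove)
  then have "norm (A $$ (i,i)) * norm (v $ i) \<le> norm ((A *\<^sub>v v) $ i) + norm ?S"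
    by (metis add_diff_cancel_right' norm_mult norm_triangle_ineq4)
  with S have "norm (v $ i) * dominance_gap A i \<le> norm ((A *\<^sub>v v) $ i)"
    using A by (simp add: dominance_gap_def algebra_simps)
  with le[OF i] have "norm (v $ i) * dominance_gap A i \<le> c * dominance_gap A i" by linarith
  then have "norm (v $ i) \<le> c" using gap[OF i] by simp
  then show ?thesis using max[OF \<open>j < n\<close>] by linarith
qed

section \<open>Contraction of the error in one step\<close>

text \<open>One step is given as a relation between \<open>e\<close> and \<open>e'\<close>, without
  an inverse. The case \<open>e = 0\<close> therefore also yields the invertibility of the
  iteration's left-hand matrix.\<close>

lemma gsor_step_contraction:
  fixes \<omega> q c :: real
  assumes T: "T \<in> carrier_mat n n" and E: "E \<in> carrier_mat n n" and F: "F \<in> carrier_mat n n"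
    and e: "e \<in> carrier_vec n" and e': "e' \<in> carrier_vec n"
    and step: "(T - complex_of_real \<omega> \<cdot>\<^sub>m E) *\<^sub>v e' =
      (complex_of_real (1 - \<omega>) \<cdot>\<^sub>m T + complex_of_real \<omega> \<cdot>\<^sub>m F) *\<^sub>v e"
    and \<omega>: "0 < \<omega>" "\<omega> \<le> 1" and q: "q < 1"
    and gap: "\<And>i. i < n \<Longrightarrow> 0 < dominance_gap T i"
    and rows: "\<And>i. i < n \<Longrightarrow> abs_row_sum E i + abs_row_sum F i \<le> q * dominance_gap T i"
    and le: "\<And>i. i < n \<Longrightarrow> norm (e $ i) \<le> c"
    and "j < n"
  shows "norm (e' $ j) \<le> (1 - \<omega> * (1 - q)) * c"
proof -
  obtain i where i: "i < n" and max: "\<And>k. k < n \<Longrightarrow> norm (e' $ k) \<le> norm (e' $ i)"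
    using ex_argmax_lessThan[OF \<open>j < n\<close>, of "\<lambda>k. norm (e' $ k)"] by blast
  \<comment> \<open>The right-hand side contains the unknown \<open>e'\<close> through
    \<open>E\<close>, so the first estimate has to be in terms of a common bound for
    \<open>e\<close> and \<open>e'\<close>.\<close>
  define \<mu> where "\<mu> = max c (norm (e' $ i))"
  have \<mu>: "norm (e $ k) \<le> \<mu>" "norm (e' $ k) \<le> \<mu>" if "k < n" for k
    using le[OF that] max[OF that] by (auto simp: \<mu>_def)
  have "0 \<le> \<mu>" using \<mu>(1)[OF i] norm_ge_zero order_trans by blast
  \<comment> \<open>Subtracting this multiple of \<open>e\<close> cancels the term with
    \<open>T\<close> and \<open>e\<close> in \<open>step\<close>; only \<open>E\<close> and
    \<open>F\<close> remain, and \<open>rows\<close> controls both.\<close>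
  define d where "d = e' - complex_of_real (1 - \<omega>) \<cdot>\<^sub>v e"
  have d: "d \<in> carrier_vec n" using e e' by (simp add: d_def)
  have "norm ((T *\<^sub>v d) $ k) \<le> (\<omega> * q * \<mu>) * dominance_gap T k" if k: "k < n" for k
  proof -
    have "(T *\<^sub>v d) $ k = \<omega> * ((E *\<^sub>v e') $ k + (F *\<^sub>v e) $ k)"
    proof -
      have "T *\<^sub>v d = T *\<^sub>v e' - complex_of_real (1 - \<omega>) \<cdot>\<^sub>v (T *\<^sub>v e)"
        unfolding d_def using T e e' by (simp add: mult_minus_distrib_mat_vec mult_mat_vec)
      then have "(T *\<^sub>v d) $ k = (T *\<^sub>v e') $ k - complex_of_real (1 - \<omega>) * (T *\<^sub>v e) $ k"
        using k T by (simp del: index_mult_mat_vec)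
      moreover have "T *\<^sub>v e' - complex_of_real \<omega> \<cdot>\<^sub>v (E *\<^sub>v e') =
          complex_of_real (1 - \<omega>) \<cdot>\<^sub>v (T *\<^sub>v e) + complex_of_real \<omega> \<cdot>\<^sub>v (F *\<^sub>v e)"
        using step minus_mult_distrib_mat_vec[OF T _ e', of "complex_of_real \<omega> \<cdot>\<^sub>m E"]
          add_mult_distrib_mat_vec[OF _ _ e, of "complex_of_real (1 - \<omega>) \<cdot>\<^sub>m T" n "complex_of_real \<omega> \<cdot>\<^sub>m F"]
          smult_mult_mat_vec[OF E e'] smult_mult_mat_vec[OF T e] smult_mult_mat_vec[OF F e] T E F
        by simp
      from arg_cong[OF this, of "\<lambda>v. v $ k"]
      have "(T *\<^sub>v e') $ k - \<omega> * (E *\<^sub>v e') $ k =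
          complex_of_real (1 - \<omega>) * (T *\<^sub>v e) $ k + \<omega> * (F *\<^sub>v e) $ k"
        using k T E F by (simp del: index_mult_mat_vec)
      ultimately show ?thesis by (simp add: algebra_simps)
    qed
    then have "norm ((T *\<^sub>v d) $ k) = \<omega> * norm ((E *\<^sub>v e') $ k + (F *\<^sub>v e) $ k)"
      using \<omega> by (simp add: norm_mult)
    also have "\<dots> \<le> \<omega> * ((abs_row_sum E k + abs_row_sum F k) * \<mu>)"
      using \<omega> norm_mult_mat_vec_le[OF E e' k \<mu>(2)] norm_mult_mat_vec_le[OF F e k \<mu>(1)]
      by (intro mult_left_mono norm_triangle_le) (auto simp: algebra_simps)
    also have "\<dots> \<le> \<omega> * ((q * dominance_gap T k) * \<mu>)"
      using \<omega> \<open>0 \<le> \<mu>\<close> rows[OF k] by (intro mult_left_mono mult_right_mono) auto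
    finally show ?thesis by (simp add: mult_ac)
  qed
  then have "norm (d $ i) \<le> \<omega> * q * \<mu>"
    using dominance_gap_solution_bound[OF T d gap _ i] by blast
  moreover have "e' $ i = complex_of_real (1 - \<omega>) * e $ i + d $ i"
    using i e e' by (simp add: d_def)
  then have "norm (e' $ i) \<le> norm (complex_of_real (1 - \<omega>) * e $ i) + norm (d $ i)"
    using norm_triangle_ineq by metis
  moreover have "norm (complex_of_real (1 - \<omega>) * e $ i) = (1 - \<omega>) * norm (e $ i)"
    using \<omega> by (simp only: norm_mult norm_of_real abs_of_nonneg diff_ge_0_iff_ge)
  moreover have "(1 - \<omega>) * norm (e $ i) \<le> (1 - \<omega>) * c"
    using \<omega> le[OF i] by (intro mult_left_mono) auto
  ultimately have main: "norm (e' $ i) \<le> (1 - \<omega>) * c + \<omega> * q * \<mu>" by linarith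
  \<comment> \<open>Otherwise \<mu> is \<open>norm (e' $ i)\<close>, and \<open>main\<close> bounds
    \<mu> by itself times a factor below 1. This forces \<mu> to be at most 0, although it exceeds
    \<open>c\<close>, which is nonnegative.\<close>
  have "norm (e' $ i) \<le> c"
  proof (rule ccontr)
    assume less: "\<not> norm (e' $ i) \<le> c"
    then have "(1 - \<omega>) * c \<le> (1 - \<omega>) * \<mu>" using \<omega> by (intro mult_left_mono) (auto simp: \<mu>_def)
    with main less have "\<mu> \<le> (1 - \<omega>) * \<mu> + \<omega> * q * \<mu>" by (simp add: \<mu>_def max_def)
    then have "(\<omega> * (1 - q)) * \<mu> \<le> 0" by (simp add: algebra_simps)
    moreover have "0 < \<omega> * (1 - q)" using \<omega> q by simp
    ultimately have "\<mu> \<le> 0" by (metis linorder_not_less mult_pos_pos)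
    moreover have "0 \<le> c" using le[OF i] norm_ge_zero order_trans by blast
    ultimately show False using less by (simp add: \<mu>_def)
  qed
  \<comment> \<open>Now \<mu> equals \<open>c\<close>, and \<open>main\<close> is the claimed
    bound.\<close>
  then have "norm (e' $ i) \<le> (1 - \<omega> * (1 - q)) * c"
    using main by (simp add: \<mu>_def max_def algebra_simps split: if_splits)
  then show ?thesis using max[OF \<open>j < n\<close>] by linarith
qed

section \<open>Invertibility, and the dominance gap under the splitting\<close>

lemma mat_inverse_if_trivial_kernel:
  fixes A :: "'a :: field mat"
  assumes A: "A \<in> carrier_mat n n"
    and "\<And>v. v \<in> carrier_vec n \<Longrightarrow> A *\<^sub>v v = 0\<^sub>v n \<Longrightarrow> v = 0\<^sub>v n"
  shows "the (mat_inverse A) \<in> carrier_mat n n"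
    and "A * the (mat_inverse A) = 1\<^sub>m n"
    and "the (mat_inverse A) * A = 1\<^sub>m n"
proof -
  have "det A \<noteq> 0" using assms det_0_iff_vec_prod_zero_field[OF A] by blast
  from det_non_zero_imp_unit[OF A this, of "()"] obtain C where "mat_inverse A = Some C"
    using mat_inverse(1)[OF A, of "()"] by (cases "mat_inverse A") auto
  then show "the (mat_inverse A) \<in> carrier_mat n n" "A * the (mat_inverse A) = 1\<^sub>m n"
    "the (mat_inverse A) * A = 1\<^sub>m n"
    using mat_inverse(2)[OF A] by auto
qed

text \<open>This is the solution bound with \<open>c = 0\<close>.\<close>

lemma dominance_gap_kernel:
  assumes A: "A \<in> carrier_mat n n" and v: "v \<in> carrier_vec n"
    and gap: "\<And>i. i < n \<Longrightarrow> 0 < dominance_gap A i"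
    and zero: "\<And>i. i < n \<Longrightarrow> (A *\<^sub>v v) $ i = 0"
  shows "v = 0\<^sub>v n"
proof (rule eq_vecI)
  show "v $ i = 0\<^sub>v n $ i" if "i < dim_vec (0\<^sub>v n)" for i
    using dominance_gap_solution_bound[OF A v gap, of 0 i] zero that by auto
qed (use v in simp)

text \<open>The three parts have disjoint supports, so the moduli of their entries add up to those
  of \<open>A\<close>. The diagonal lies in the band, hence the other two parts contribute only to
  the off-diagonal sum.\<close>

lemma dominance_gap_splitting:
  assumes A: "A \<in> carrier_mat n n" and i: "i < n"
  shows "dominance_gap A i =
    dominance_gap (band_part m A) i - abs_row_sum (lower_part m A) i - abs_row_sum (upper_part m A) i"
proof -
  let ?S = "{..<n} - {i}"
  have "(\<Sum>j<n. norm (lower_part m A $$ (i,j))) = (\<Sum>j\<in>?S. norm (lower_part m A $$ (i,j)))"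
    "(\<Sum>j<n. norm (upper_part m A $$ (i,j))) = (\<Sum>j\<in>?S. norm (upper_part m A $$ (i,j)))"
    using A i by (auto simp: sum.remove lower_part_def upper_part_def)
  moreover have "(\<Sum>j\<in>?S. norm (A $$ (i,j))) = (\<Sum>j\<in>?S. norm (band_part m A $$ (i,j)) +
      norm (lower_part m A $$ (i,j)) + norm (upper_part m A $$ (i,j)))"
    using A i by (intro sum.cong) (auto simp: band_part_def lower_part_def upper_part_def)
  moreover have "band_part m A $$ (i,i) = A $$ (i,i)" using A i by (simp add: band_part_def)
  moreover have "dim_col (band_part m A) = n" "dim_col (lower_part m A) = n"
    "dim_col (upper_part m A) = n" "dim_col A = n"
    using A by (simp_all add: band_part_def lower_part_def upper_part_def)
  ultimately show ?thesis
    by (simp add: dominance_gap_def abs_row_sum_def sum.distrib)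
qed

text \<open>The largest of finitely many ratios below 1 is still below 1. Inserting 0 makes the
  maximum nonnegative, and well defined even for \<open>n = 0\<close>.\<close>

lemma ex_uniform_ratio:
  fixes f g :: "nat \<Rightarrow> real"
  assumes "\<And>i. i < n \<Longrightarrow> f i < g i" and "\<And>i. i < n \<Longrightarrow> 0 < g i"
  obtains q where "0 \<le> q" "q < 1" "\<And>i. i < n \<Longrightarrow> f i \<le> q * g i"
proof
  define q where "q = Max (insert 0 ((\<lambda>i. f i / g i) ` {..<n}))"
  show "0 \<le> q" unfolding q_def by (rule Max_ge) auto
  show "q < 1" unfolding q_def using assms by (subst Max_less_iff) auto
  show "f i \<le> q * g i" if "i < n" for i
  proof -
    have "f i / g i \<le> q" unfolding q_def using that by (intro Max_ge) auto
    then show ?thesis using assms(2)[OF that] by (simp add: field_simps)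
  qed
qed

section \<open>Convergence of the GSOR iteration\<close>

theorem theorem3p17:
  fixes A :: "complex mat" and n m :: nat and \<omega> :: real
  assumes "A \<in> carrier_mat n n"
    and "strictly_diagonally_dominant A"
    and "1 \<le> m" and "m < n"
    and "0 < \<omega>" and "\<omega> \<le> 1"
  shows "gsor_converges A m \<omega>"
proof -
  note A = assms(1)
  define T where "T = band_part m A"
  define E where "E = lower_part m A"
  define F where "F = upper_part m A"
  define M where "M = gsor_lhs A m \<omega>"
  define N where "N = gsor_rhs A m \<omega>"
  have T: "T \<in> carrier_mat n n" and E: "E \<in> carrier_mat n n" and F: "F \<in> carrier_mat n n"
    using A by (auto simp: T_def E_def F_def band_part_def lower_part_def upper_part_def)
  have M_eq: "M = T - complex_of_real \<omega> \<cdot>\<^sub>m E"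
    and N_eq: "N = complex_of_real (1 - \<omega>) \<cdot>\<^sub>m T + complex_of_real \<omega> \<cdot>\<^sub>m F"
    by (simp_all add: M_def N_def gsor_lhs_def gsor_rhs_def T_def E_def F_def)
  have M: "M \<in> carrier_mat n n" and N: "N \<in> carrier_mat n n"
    using T E F by (auto simp: M_eq N_eq)
  have gapA: "0 < dominance_gap A i" if "i < n" for i
    using assms(1,2) that by (simp add: dominance_gap_def strictly_diagonally_dominant_def)
  have row: "abs_row_sum E i + abs_row_sum F i < dominance_gap T i" if "i < n" for i
    using gapA[OF that] dominance_gap_splitting[OF A that, of m] by (simp add: T_def E_def F_def)
  have gap: "0 < dominance_gap T i" if "i < n" for i
    using row[OF that] abs_row_sum_nonneg[of E i] abs_row_sum_nonneg[of F i] by linarith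
  obtain q where q: "0 \<le> q" "q < 1"
    and rows: "\<And>i. i < n \<Longrightarrow> abs_row_sum E i + abs_row_sum F i \<le> q * dominance_gap T i"
    using ex_uniform_ratio[of n "\<lambda>i. abs_row_sum E i + abs_row_sum F i" "dominance_gap T"]
      row gap by metis
  \<comment> \<open>The contraction factor; \<open>0 \<le> q\<close> ensures that it is not
    negative.\<close>
  define r where "r = 1 - \<omega> * (1 - q)"
  have "\<omega> * (1 - q) \<le> 1" using assms q by (intro mult_le_one) auto
  moreover have "0 < \<omega> * (1 - q)" using assms q by auto
  ultimately have r: "0 \<le> r" "r < 1" by (simp_all add: r_def)
  have step: "norm (e' $ j) \<le> r * c"
    if "e \<in> carrier_vec n" "e' \<in> carrier_vec n" "M *\<^sub>v e' = N *\<^sub>v e"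
      "\<And>i. i < n \<Longrightarrow> norm (e $ i) \<le> c" "j < n" for e e' c j
    unfolding r_def
    using gsor_step_contraction[OF T E F that(1,2) _ assms(5,6) q(2) gap rows that(4,5)] that(3)
    unfolding M_eq N_eq by blast
  \<comment> \<open>A kernel vector is a possible successor of the error 0, so the contraction with
    \<open>c = 0\<close> makes it vanish.\<close>
  have kerM: "v = 0\<^sub>v n" if v: "v \<in> carrier_vec n" "M *\<^sub>v v = 0\<^sub>v n" for v
  proof (rule eq_vecI)
    have "M *\<^sub>v v = N *\<^sub>v 0\<^sub>v n" using v N by (auto intro!: eq_vecI)
    then show "v $ i = 0\<^sub>v n $ i" if "i < dim_vec (0\<^sub>v n)" for i
      using step[of "0\<^sub>v n" v 0 i] v(1) that by simp
  qed (use v in simp)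
  define P where "P = the (mat_inverse M)"
  have P: "P \<in> carrier_mat n n" "M * P = 1\<^sub>m n" "P * M = 1\<^sub>m n"
    using mat_inverse_if_trivial_kernel[OF M kerM] by (simp_all add: P_def)
  have "invertible_mat M"
    using M P unfolding invertible_mat_def inverts_mat_def by auto
  have "v = 0\<^sub>v n" if "v \<in> carrier_vec n" "A *\<^sub>v v = 0\<^sub>v n" for v
    using dominance_gap_kernel[OF A that(1) gapA] that(2) by simp
  note invA = mat_inverse_if_trivial_kernel[OF A this]
  \<comment> \<open>Consistency of the splitting: a solution of the linear system is a fixed point
    of the iteration.\<close>
  have "M = N + complex_of_real \<omega> \<cdot>\<^sub>m A"
  proof -
    have "A = T - E - F" unfolding T_def E_def F_def by (rule splitting)
    then show ?thesis using T E F by (auto simp: M_eq N_eq algebra_simps intro!: eq_matI)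
  qed
  then have split: "M *\<^sub>v x = N *\<^sub>v x + complex_of_real \<omega> \<cdot>\<^sub>v (A *\<^sub>v x)" if "x \<in> carrier_vec n" for x
    using add_mult_distrib_mat_vec[OF N _ that, of "complex_of_real \<omega> \<cdot>\<^sub>m A"] A
      smult_mult_mat_vec[OF A that] by simp
  have "\<exists>x. {y \<in> carrier_vec n. A *\<^sub>v y = b} = {x} \<and>
      (\<forall>x0 \<in> carrier_vec n. vec_converges_to n (gsor_iterate A m \<omega> b x0) x)"
    if b: "b \<in> carrier_vec n" for b
  proof -
    define x where "x = the (mat_inverse A) *\<^sub>v b"
    have x: "x \<in> carrier_vec n" using invA b by (simp add: x_def)
    have Ax: "A *\<^sub>v x = b"
      unfolding x_def using assoc_mult_mat_vec[OF A invA(1) b] invA(2) b by simp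
    have "y = x" if "y \<in> carrier_vec n" "A *\<^sub>v y = b" for y
      unfolding x_def that(2)[symmetric]
      using assoc_mult_mat_vec[OF invA(1) A that(1)] invA(3) that(1) by simp
    then have sol: "{y \<in> carrier_vec n. A *\<^sub>v y = b} = {x}" using x Ax by blast
    have "vec_converges_to n (gsor_iterate A m \<omega> b x0) x" if x0: "x0 \<in> carrier_vec n" for x0
    proof -
      define X where "X = gsor_iterate A m \<omega> b x0"
      have X_Suc: "X (Suc k) = (P * N) *\<^sub>v X k + complex_of_real \<omega> \<cdot>\<^sub>v (P *\<^sub>v b)" for k
        unfolding X_def P_def M_def N_def by (rule gsor_iterate.simps(2))
      have X: "X k \<in> carrier_vec n" for k
      proof (cases k)
        case 0
        then show ?thesis using x0 by (simp add: X_def)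
      next
        case (Suc l)
        have "P * N \<in> carrier_mat n n" using P(1) N by simp
        then have "dim_vec (X (Suc l)) = n" unfolding X_Suc using P(1) by simp
        then show ?thesis unfolding Suc by (rule carrier_vecI)
      qed
      \<comment> \<open>Multiplying by \<open>M\<close> removes the inverse \<open>P\<close> and
        brings the iteration into the form that the contraction needs.\<close>
      have MX: "M *\<^sub>v X (Suc k) = N *\<^sub>v X k + complex_of_real \<omega> \<cdot>\<^sub>v b" for k
      proof -
        have NX: "N *\<^sub>v X k \<in> carrier_vec n" using N X by simp
        have "X (Suc k) = P *\<^sub>v (N *\<^sub>v X k + complex_of_real \<omega> \<cdot>\<^sub>v b)"
          using P(1) N X b NX
          by (simp add: X_Suc assoc_mult_mat_vec[OF P(1) N X] mult_add_distrib_mat_vec[OF P(1)]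
              mult_mat_vec[OF P(1)])
        then show ?thesis
          using assoc_mult_mat_vec[OF M P(1), of "N *\<^sub>v X k + complex_of_real \<omega> \<cdot>\<^sub>v b"] P(2) NX b
          by simp
      qed
      define e where "e k = X k - x" for k
      have e: "e k \<in> carrier_vec n" for k using X x by (simp add: e_def)
      \<comment> \<open>The fixed point equation for \<open>x\<close> is subtracted from
        \<open>MX\<close>, and the terms with \<open>b\<close> cancel.\<close>
      have Me: "M *\<^sub>v e (Suc k) = N *\<^sub>v e k" for k
      proof -
        have "M *\<^sub>v e (Suc k) = M *\<^sub>v X (Suc k) - M *\<^sub>v x" "N *\<^sub>v e k = N *\<^sub>v X k - N *\<^sub>v x"
          unfolding e_def using M N X x by (auto intro: mult_minus_distrib_mat_vec)
        moreover have "(u + w) - (v + w) = u - v"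
          if "u \<in> carrier_vec n" "v \<in> carrier_vec n" "w \<in> carrier_vec n" for u v w :: "complex vec"
          using that by (auto intro!: eq_vecI)
        from this[of "N *\<^sub>v X k" "N *\<^sub>v x" "complex_of_real \<omega> \<cdot>\<^sub>v b"]
        have "M *\<^sub>v X (Suc k) - M *\<^sub>v x = N *\<^sub>v X k - N *\<^sub>v x"
          unfolding MX split[OF x] Ax using b mult_mat_vec_carrier[OF N X] mult_mat_vec_carrier[OF N x] by simp
        ultimately show ?thesis by (simp only:)
      qed
      \<comment> \<open>The index \<open>m\<close> witnesses that \<open>n\<close> is positive, so
        the maximum norm of the initial error is attained.\<close>
      obtain i where c: "\<And>k. k < n \<Longrightarrow> norm (e 0 $ k) \<le> norm (e 0 $ i)"
        using ex_argmax_lessThan[OF assms(4), of "\<lambda>k. norm (e 0 $ k)"] by blast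
      define c where "c = norm (e 0 $ i)"
      \<comment> \<open>The component \<open>i\<close> is arbitrary in the induction because one
        contraction step needs the bound on all components of the previous error.\<close>
      have decay: "norm (e k $ i) \<le> r ^ k * c" if "i < n" for k i
        using that
      proof (induction k arbitrary: i)
        case 0
        then show ?case using c by (simp add: c_def)
      next
        case (Suc k)
        then show ?case using step[OF e e Me Suc.IH] by (simp add: mult.assoc)
      qed
      have "(\<lambda>k. X k $ i) \<longlonglongrightarrow> x $ i" if i: "i < n" for i
      proof -
        have "norm (X k $ i - x $ i) \<le> norm (r ^ k) * c" for k
          using decay[OF i, of k] i x X[of k] r by (simp add: e_def)
        then have "(\<lambda>k. X k $ i - x $ i) \<longlonglongrightarrow> 0"
          by (intro tendsto_0_le[OF LIMSEQ_realpow_zero[OF r]] always_eventually) blast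
        then show ?thesis by (simp add: LIM_zero_iff)
      qed
      then show ?thesis
        unfolding vec_converges_to_def X_def[symmetric] using X x by blast
    qed
    then show ?thesis using sol by blast
  qed
  then show ?thesis
    unfolding gsor_converges_def using \<open>invertible_mat M\<close> A by (simp add: M_def)
qed

end
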